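(* Let $\mathcal{C}=(C_1,\ldots,C_m)$ be a camera arrangement. (1) Let $L\subseteq\mathbb{P}^3$ be a line containing no center. Let $\phi_L:L\to\mathbb{P}^1$ and $\psi_i:C_i\cdot L\to\mathbb{P}^1$ ($i=1,\ldots,m$) be any linear isomorphisms, and let $\widetilde{\mathcal{C}}=(\widetilde C_1,\ldots,\widetilde C_m)$ with $\widetilde C_i=\psi_i\circ C_i\circ\phi_L^{-1}$ (a $2\times2$ matrix). Then $(\psi_1,\ldots,\psi_m):\mathcal{M}_\mathcal{C}^L\to\mathcal{M}^{1,1}_{\widetilde{\mathcal{C}}}$ is a linear isomorphism. (2) Let $X\in\mathbb{P}^3$ be distinct from all centers. Let $\phi_X:\Lambda(X)\to\mathbb{P}^2$ and $\psi_i:\Lambda(C_iX)\to\mathbb{P}^1$ ($i=1,\ldots,m$) be any linear isomorphisms, and let $\widehat{\mathcal{C}}=(\widehat C_1,\ldots,\widehat C_m)$ with $\widehat C_i=\psi_i\circ C_i\circ\phi_X^{-1}$ (a $2\times 3$ matrix). Then $(\psi_1,\ldots,\psi_m):\mathcal{L}_\mathcal{C}^X\to\mathcal{M}^{2,1}_{\widehat{\mathcal{C}}}$ is a linear isomorphism.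
   Context: All spaces are complex projective. A camera is a full-rank $3\times4$ complex matrix $C:\mathbb{P}^3\dashrightarrow\mathbb{P}^2$ with center its kernel; a camera arrangement $\mathcal{C}=(C_1,\ldots,C_m)$, $m\ge 2$, has pairwise distinct centers. For a line $L$ spanned by $u,v$, $C\cdot L:=Cu\times Cv\in\mathbb{P}^2$, identified with the image line $\{x:(C\cdot L)^Tx=0\}\subseteq\mathbb{P}^2$ (a copy of $\mathbb{P}^1$). $\Lambda(X)$ is the set of lines in $\mathbb{P}^3$ through $X$ (a plane in the Plücker embedding of the Grassmannian of lines), and for a point $y\in\mathbb{P}^2$, $\Lambda(y)$ is the set of lines in $\mathbb{P}^2$ through $y$ (a line in the dual plane); $C_i$ maps a line through $X$ not through $c_i$ to a line through $C_iX$, so $C_i\circ\phi_X^{-1}$ is a linear map $\mathbb{P}^2\dashrightarrow\Lambda(C_iX)$. $\mathcal{M}_\mathcal{C}^L$ is the Zariski closure of the image of $L\ni Y\mapsto(C_1Y,\ldots,C_mY)$; $\mathcal{L}_\mathcal{C}^X$ is the Zariski closure of the image of $\Lambda(X)\ni L'\mapsto(C_1\cdot L',\ldots,C_m\cdot L')$. For an arrangement $\widetilde{\mathcal{C}}$ of full-rank $2\times2$ matrices, $\mathcal{M}^{1,1}_{\widetilde{\mathcal{C}}}\subseteq(\mathbb{P}^1)^m$ is the Zariski closure of the image of $\mathbb{P}^1\ni Y\mapsto(\widetilde C_1Y,\ldots,\widetilde C_mY)$; for an arrangement $\widehat{\mathcal{C}}$ of full-rank $2\times 3$ matrices, $\mathcal{M}^{2,1}_{\widehat{\mathcal{C}}}\subseteq(\mathbb{P}^1)^m$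 is the Zariski closure of the image of $\mathbb{P}^2\dashrightarrow(\mathbb{P}^1)^m$, $Y\mapsto(\widehat C_1Y,\ldots,\widehat C_mY)$. A linear isomorphism means an invertible linear map. *)

theory Defs
  imports "HOL-Analysis.Analysis"
begin

text \<open>Conventions. A point of P^n is represented by any nonzero vector of complex^(n+1).
  A subset of a product of projective spaces P^(n-1) x ... x P^(n-1) (one factor per
  index in the finite type 'm) is represented by the set of all tuples of representatives,
  i.e. functions y :: 'm => complex^'n with every y i nonzero.\<close>

text \<open>Bilinear (non-Hermitian) dot product and cross product on complex^3.\<close>
definition bdot :: "complex^'n \<Rightarrow> complex^'n \<Rightarrow> complex" where
  "bdot x y = (\<Sum>k\<in>UNIV. x $ k * y $ k)"

definition ccross :: "complex^3 \<Rightarrow> complex^3 \<Rightarrow> complex^3" where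
  "ccross a b = vector [a$2 * b$3 - a$3 * b$2, a$3 * b$1 - a$1 * b$3, a$1 * b$2 - a$2 * b$1]"

text \<open>Monomials and multihomogeneous polynomials on tuples of vectors.\<close>
definition monom :: "('m::finite \<Rightarrow> 'n::finite \<Rightarrow> nat) \<Rightarrow> ('m \<Rightarrow> complex^'n) \<Rightarrow> complex" where
  "monom e y = (\<Prod>i\<in>UNIV. \<Prod>j\<in>UNIV. (y i $ j) ^ (e i j))"

definition multihom_poly ::
  "('m::finite \<Rightarrow> nat) \<Rightarrow> (('m \<Rightarrow> complex^'n::finite) \<Rightarrow> complex) \<Rightarrow> bool" where
  "multihom_poly d p \<longleftrightarrow> (\<exists>E coef. finite E \<and> (\<forall>e\<in>E. \<forall>i. (\<Sum>j\<in>UNIV. e i j) = d i) \<and>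
      p = (\<lambda>y. \<Sum>e\<in>E. coef e * monom e y))"

text \<open>Zariski closure in the product of projective spaces (closed sets are common zero sets
  of multihomogeneous polynomials).\<close>
definition zariski_closure :: "('m::finite \<Rightarrow> complex^'n::finite) set \<Rightarrow> ('m \<Rightarrow> complex^'n) set" where
  "zariski_closure S = {y. (\<forall>i. y i \<noteq> 0) \<and>
      (\<forall>d p. multihom_poly d p \<and> (\<forall>z\<in>S. p z = 0) \<longrightarrow> p y = 0)}"

text \<open>Equality of tuples of projective points (componentwise up to nonzero scalars).\<close>
definition proj_tuple_eq :: "('m \<Rightarrow> complex^'n) \<Rightarrow> ('m \<Rightarrow> complex^'n) \<Rightarrow> bool" where
  "proj_tuple_eq y z \<longleftrightarrow> (\<forall>i. \<exists>c. c \<noteq> 0 \<and> z i = c *s y i)"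

text \<open>Camera arrangement: full-rank 3x4 matrices with pairwise distinct centers (kernels).\<close>
definition is_center :: "complex^4^3 \<Rightarrow> complex^4 \<Rightarrow> bool" where
  "is_center C c \<longleftrightarrow> c \<noteq> 0 \<and> C *v c = 0"

definition camera_arrangement :: "('m::finite \<Rightarrow> complex^4^3) \<Rightarrow> bool" where
  "camera_arrangement C \<longleftrightarrow> CARD('m) \<ge> 2 \<and> (\<forall>i. rank (C i) = 3) \<and>
     (\<forall>i j. i \<noteq> j \<longrightarrow> \<not> (\<exists>c. is_center (C i) c \<and> is_center (C j) c))"

text \<open>A line L in P^3 spanned by u, v (linearly independent) corresponds to the 2-dim subspace
  vec.span {u,v}. C.L := Cu x Cv; the image line is {x. (C.L)^T x = 0}.\<close>
definition cam_line :: "complex^4^3 \<Rightarrow> complex^4 \<Rightarrow> complex^4 \<Rightarrow> complex^3" where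
  "cam_line C u v = ccross (C *v u) (C *v v)"

definition image_line :: "complex^3 \<Rightarrow> (complex^3) set" where
  "image_line l = {x. bdot l x = 0}"

text \<open>Lines through a point y of P^2: a line in the dual plane.\<close>
definition dual_pencil :: "complex^3 \<Rightarrow> (complex^3) set" where
  "dual_pencil y = {l. bdot l y = 0}"

text \<open>Pluecker coordinates of the line spanned by u and v.\<close>
definition pluecker :: "complex^4 \<Rightarrow> complex^4 \<Rightarrow> complex^6" where
  "pluecker u v = vector [u$1* v$2 - u$2* v$1, u$1* v$3 - u$3* v$1, u$1* v$4 - u$4* v$1,
                          u$2* v$3 - u$3* v$2, u$2* v$4 - u$4* v$2, u$3* v$4 - u$4* v$3]"

text \<open>Lambda(X) in the Pluecker embedding: the (cone over the) plane of Pluecker vectors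
  of lines through X, i.e. the 3-dimensional linear space {pluecker X Z | Z}.\<close>
definition Lambda_pt :: "complex^4 \<Rightarrow> (complex^6) set" where
  "Lambda_pt X = range (pluecker X)"

text \<open>C applied to the line through X with Pluecker vector p (p in Lambda_pt X):
  choose Z with p = pluecker X Z; the line is spanned by X and Z.\<close>
definition cam_on_Lambda :: "complex^4^3 \<Rightarrow> complex^4 \<Rightarrow> complex^6 \<Rightarrow> complex^3" where
  "cam_on_Lambda C X p = cam_line C X (SOME Z. pluecker X Z = p)"

text \<open>The varieties.\<close>
definition M_line :: "('m::finite \<Rightarrow> complex^4^3) \<Rightarrow> complex^4 \<Rightarrow> complex^4 \<Rightarrow> ('m \<Rightarrow> complex^3) set" where
  "M_line C u v = zariski_closure
     {(\<lambda>i. C i *v Y) | Y. Y \<in> vec.span {u, v} \<and> Y \<noteq> 0 \<and> (\<forall>i. C i *v Y \<noteq> 0)}"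

definition L_point :: "('m::finite \<Rightarrow> complex^4^3) \<Rightarrow> complex^4 \<Rightarrow> ('m \<Rightarrow> complex^3) set" where
  "L_point C X = zariski_closure
     {(\<lambda>i. cam_line (C i) X Z) | Z. vec.independent {X, Z} \<and> X \<noteq> Z \<and> (\<forall>i. cam_line (C i) X Z \<noteq> 0)}"

definition M11 :: "('m::finite \<Rightarrow> complex^2^2) \<Rightarrow> ('m \<Rightarrow> complex^2) set" where
  "M11 A = zariski_closure {(\<lambda>i. A i *v Y) | Y. Y \<noteq> 0 \<and> (\<forall>i. A i *v Y \<noteq> 0)}"

definition M21 :: "('m::finite \<Rightarrow> complex^3^2) \<Rightarrow> ('m \<Rightarrow> complex^2) set" where
  "M21 A = zariski_closure {(\<lambda>i. A i *v Y) | Y. Y \<noteq> 0 \<and> (\<forall>i. A i *v Y \<noteq> 0)}"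

end

theory Submission
  imports Defs
begin

text \<open>Both varieties are Zariski closures of parametrized sets: \<open>M_line C u v\<close> of the
  tuples \<open>(C\<^sub>i Y)\<^sub>i\<close> for \<open>Y\<close> on \<open>L\<close>, and \<open>L_point C X\<close> of the tuples of image lines
  \<open>(C\<^sub>i \<cdot> L')\<^sub>i\<close> for \<open>L'\<close> through \<open>X\<close>, which Pluecker coordinates parametrize linearly by
  \<open>\<Lambda>(X)\<close>. Every \<open>C\<^sub>i Y\<close> lies on the image line \<open>C\<^sub>i \<cdot> L\<close> and every \<open>C\<^sub>i \<cdot> L'\<close> in the pencil
  \<open>\<Lambda>(C\<^sub>i X)\<close>; both are hyperplanes of \<open>\<complex>\<^sup>3\<close> on which \<open>\<psi>\<^sub>i\<close> is a linear isomorphism.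
  So \<open>\<psi>\<close> maps the parametrized set onto the one of the reduced arrangement, whose
  matrices \<open>\<psi>\<^sub>i C\<^sub>i \<phi>\<^sup>-\<^sup>1\<close> are linear. Composing a multihomogeneous polynomial with
  componentwise linear maps gives a multihomogeneous polynomial of the same multidegree;
  applied to \<open>\<psi>\<close> and to its inverse this shows that \<open>\<psi>\<close> commutes with Zariski closure,
  and since \<open>\<psi>\<^sub>i\<close> is injective on the hyperplane, \<open>\<psi>\<close> also reflects projective equality.\<close>

section \<open>Multihomogeneous polynomials\<close>

lemma multihom_polyI:
  assumes "finite A" and "\<And>x i. x \<in> A \<Longrightarrow> (\<Sum>j\<in>UNIV. g x i j) = d i"
    and "\<And>y. p y = (\<Sum>x\<in>A. c x * monom (g x) y)"
  shows "multihom_poly d p"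
proof -
  define coef where "coef e = (\<Sum>x\<in>{x\<in>A. g x = e}. c x)" for e
  have "p y = (\<Sum>e\<in>g ` A. coef e * monom e y)" for y
  proof -
    have "(\<Sum>e\<in>g ` A. coef e * monom e y) = (\<Sum>e\<in>g ` A. \<Sum>x\<in>{x\<in>A. g x = e}. c x * monom (g x) y)"
      unfolding coef_def sum_distrib_right by (rule sum.cong) auto
    also have "\<dots> = (\<Sum>x\<in>A. c x * monom (g x) y)"
      by (rule sum.group) (use assms in auto)
    finally show ?thesis using assms(3) by simp
  qed
  then show ?thesis
    unfolding multihom_poly_def using assms by (intro exI[of _ "g ` A"] exI[of _ coef]) auto
qed

lemma multihom_polyE:
  assumes "multihom_poly d p"
  obtains E coef where "finite E" and "\<And>e i. e \<in> E \<Longrightarrow> (\<Sum>j\<in>UNIV. e i j) = d i"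
    and "\<And>y. p y = (\<Sum>e\<in>E. coef e * monom e y)"
  using assms unfolding multihom_poly_def by metis

lemma multihom_poly_0: "multihom_poly d (\<lambda>y. 0)"
  by (rule multihom_polyI[where A = "{}"]) auto

lemma multihom_poly_1: "multihom_poly (\<lambda>_. 0) (\<lambda>y. 1)"
  by (rule multihom_polyI[where A = "{()}" and g = "\<lambda>_ i j. 0" and c = "\<lambda>_. 1"])
    (auto simp: monom_def)

lemma multihom_poly_add:
  assumes "multihom_poly d p" and "multihom_poly d q"
  shows "multihom_poly d (\<lambda>y. p y + q y)"
proof -
  obtain E1 c1 where 1: "finite E1" "\<And>e i. e \<in> E1 \<Longrightarrow> (\<Sum>j\<in>UNIV. e i j) = d i"
    "\<And>y. p y = (\<Sum>e\<in>E1. c1 e * monom e y)" using assms(1) by (rule multihom_polyE) blast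
  obtain E2 c2 where 2: "finite E2" "\<And>e i. e \<in> E2 \<Longrightarrow> (\<Sum>j\<in>UNIV. e i j) = d i"
    "\<And>y. q y = (\<Sum>e\<in>E2. c2 e * monom e y)" using assms(2) by (rule multihom_polyE) blast
  show ?thesis
    by (rule multihom_polyI[where A = "E1 <+> E2" and g = "case_sum id id" and c = "case_sum c1 c2"])
      (use 1 2 in \<open>auto simp: sum.Plus o_def\<close>)
qed

lemma multihom_poly_cmult:
  assumes "multihom_poly d p"
  shows "multihom_poly d (\<lambda>y. a * p y)"
proof -
  obtain E c where "finite E" "\<And>e i. e \<in> E \<Longrightarrow> (\<Sum>j\<in>UNIV. e i j) = d i"
    "\<And>y. p y = (\<Sum>e\<in>E. c e * monom e y)" using assms by (rule multihom_polyE) blast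
  then show ?thesis
    by (intro multihom_polyI[where A = E and g = id and c = "\<lambda>e. a * c e"])
      (auto simp: sum_distrib_left mult.assoc)
qed

lemma monom_add: "monom (\<lambda>i j. e i j + f i j) y = monom e y * monom f y"
  by (simp add: monom_def power_add prod.distrib)

lemma multihom_poly_mult:
  assumes "multihom_poly d1 p" and "multihom_poly d2 q"
  shows "multihom_poly (\<lambda>i. d1 i + d2 i) (\<lambda>y. p y * q y)"
proof -
  obtain E1 c1 where 1: "finite E1" "\<And>e i. e \<in> E1 \<Longrightarrow> (\<Sum>j\<in>UNIV. e i j) = d1 i"
    "\<And>y. p y = (\<Sum>e\<in>E1. c1 e * monom e y)" using assms(1) by (rule multihom_polyE) blast
  obtain E2 c2 where 2: "finite E2" "\<And>e i. e \<in> E2 \<Longrightarrow> (\<Sum>j\<in>UNIV. e i j) = d2 i"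
    "\<And>y. q y = (\<Sum>e\<in>E2. c2 e * monom e y)" using assms(2) by (rule multihom_polyE) blast
  show ?thesis
  proof (rule multihom_polyI[where A = "E1 \<times> E2" and g = "\<lambda>(e, f) i j. e i j + f i j"
        and c = "\<lambda>(e, f). c1 e * c2 f"])
    fix y
    have "p y * q y = (\<Sum>(e, f)\<in>E1 \<times> E2. (c1 e * monom e y) * (c2 f * monom f y))"
      by (simp add: 1 2 sum_product sum.cartesian_product)
    also have "\<dots> = (\<Sum>x\<in>E1 \<times> E2. (case x of (e, f) \<Rightarrow> c1 e * c2 f)
        * monom ((\<lambda>(e, f) i j. e i j + f i j) x) y)"
      by (rule sum.cong) (auto simp: monom_add)
    finally show "p y * q y = \<dots>" .
  qed (use 1 2 in \<open>auto simp: sum.distrib\<close>)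
qed

lemma multihom_poly_prod:
  assumes "finite K" and "\<And>k. k \<in> K \<Longrightarrow> multihom_poly (d k) (p k)"
  shows "multihom_poly (\<lambda>i. \<Sum>k\<in>K. d k i) (\<lambda>y. \<Prod>k\<in>K. p k y)"
  using assms
proof (induction K rule: finite_induct)
  case empty
  then show ?case using multihom_poly_1 by simp
next
  case (insert k K)
  then show ?case using multihom_poly_mult[of "d k" "p k"] by simp
qed

lemma multihom_poly_sum:
  assumes "finite K" and "\<And>k. k \<in> K \<Longrightarrow> multihom_poly d (p k)"
  shows "multihom_poly d (\<lambda>y. \<Sum>k\<in>K. p k y)"
  using assms
proof (induction K rule: finite_induct)
  case empty
  then show ?case using multihom_poly_0 by simp
next
  case (insert k K)
  then show ?case using multihom_poly_add[of d "p k"] by simp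
qed

lemma multihom_poly_power:
  assumes "multihom_poly d p"
  shows "multihom_poly (\<lambda>i. n * d i) (\<lambda>y. p y ^ n)"
  using multihom_poly_prod[of "{..<n}" "\<lambda>_. d" "\<lambda>_. p"] assms by simp

lemma monom_single: "monom (\<lambda>i' j. if i' = i \<and> j = k then 1 else 0) y = y i $ k"
proof -
  have "monom (\<lambda>i' j. if i' = i \<and> j = k then 1 else 0) y
      = (\<Prod>i'\<in>UNIV. \<Prod>j\<in>UNIV. if j = k then (if i' = i then y i' $ j else 1) else 1)"
    unfolding monom_def by (intro prod.cong) auto
  also have "\<dots> = y i $ k"
    by simp
  finally show ?thesis .
qed

lemma multihom_poly_coord: "multihom_poly (\<lambda>i'. if i' = i then 1 else 0) (\<lambda>y. y i $ k)"
  by (rule multihom_polyI[where A = "{()}" and g = "\<lambda>_ i' j. if i' = i \<and> j = k then 1 else 0"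
        and c = "\<lambda>_. 1"])
    (auto simp: monom_single)

lemma multihom_poly_linear_form:
  "multihom_poly (\<lambda>i'. if i' = i then 1 else 0) (\<lambda>y. \<Sum>k\<in>UNIV. a k * y i $ k)"
  by (intro multihom_poly_sum multihom_poly_cmult multihom_poly_coord) simp

lemma multihom_poly_monom_matrix:
  fixes A :: "'m::finite \<Rightarrow> complex^'n::finite^'k::finite"
  assumes "\<And>i. (\<Sum>j\<in>UNIV. e i j) = d i"
  shows "multihom_poly d (\<lambda>y. monom e (\<lambda>i. A i *v y i))"
proof -
  have "multihom_poly (\<lambda>i'. \<Sum>i\<in>UNIV. \<Sum>j\<in>UNIV. e i j * (if i' = i then 1 else 0))
      (\<lambda>y. \<Prod>i\<in>UNIV. \<Prod>j\<in>UNIV. (\<Sum>k\<in>UNIV. A i $ j $ k * y i $ k) ^ e i j)"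
    by (intro multihom_poly_prod multihom_poly_power multihom_poly_linear_form) simp_all
  moreover have "(\<lambda>i'. \<Sum>i\<in>UNIV. \<Sum>j\<in>UNIV. e i j * (if i' = i then 1 else 0)) = d"
    using assms by (simp add: fun_eq_iff flip: sum_distrib_right of_bool_def)
  ultimately show ?thesis
    by (simp add: monom_def matrix_vector_mult_def)
qed

lemma multihom_poly_compose_linear:
  fixes f :: "'m::finite \<Rightarrow> complex^'n::finite \<Rightarrow> complex^'k::finite"
  assumes p: "multihom_poly d p" and f: "\<And>i. Vector_Spaces.linear (*s) (*s) (f i)"
  shows "multihom_poly d (\<lambda>y. p (\<lambda>i. f i (y i)))"
proof -
  obtain E coef where E: "finite E" "\<And>e i. e \<in> E \<Longrightarrow> (\<Sum>j\<in>UNIV. e i j) = d i"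
    and p_eq: "\<And>y. p y = (\<Sum>e\<in>E. coef e * monom e y)" using p by (rule multihom_polyE) blast
  have "multihom_poly d (\<lambda>y. \<Sum>e\<in>E. coef e * monom e (\<lambda>i. matrix (f i) *v y i))"
    using E by (intro multihom_poly_sum multihom_poly_cmult multihom_poly_monom_matrix)
  then show ?thesis
    by (simp add: p_eq matrix_works[OF f])
qed

section \<open>Zariski closure under componentwise linear isomorphisms\<close>

lemma linear_vecI:
  fixes f :: "'a::field^'n \<Rightarrow> 'a^'k"
  assumes "\<And>x y. f (x + y) = f x + f y" and "\<And>c x. f (c *s x) = c *s f x"
  shows "Vector_Spaces.linear (*s) (*s) f"
  using assms by (simp add: Vector_Spaces.linear_iff vec.vector_space_axioms)

lemma linear_inv_into_subspace:
  fixes f :: "'a::field^'n \<Rightarrow> 'a^'k"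
  assumes W: "vec.subspace W" and f: "Vector_Spaces.linear (*s) (*s) f"
    and bij: "bij_betw f W UNIV"
  shows "Vector_Spaces.linear (*s) (*s) (inv_into W f)"
proof -
  have inj: "inj_on f W" and surj: "f ` W = UNIV"
    using bij by (auto simp: bij_betw_def)
  then have inv_in: "inv_into W f z \<in> W" and f_inv: "f (inv_into W f z) = z" for z
    by (auto intro: inv_into_into f_inv_into_f)
  show ?thesis
    by (rule linear_vecI; rule inj_onD[OF inj])
      (simp_all add: inv_in f_inv vec.linear_add[OF f] vec.linear_scale[OF f]
        vec.subspace_add[OF W] vec.subspace_scale[OF W])
qed

lemma subspace_hyperplane: "vec.subspace {x. bdot a x = 0}"
  unfolding vec.subspace_def bdot_def
  by (simp add: distrib_left sum.distrib mult.left_commute flip: sum_distrib_left)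

lemma bdot_commute: "bdot x y = bdot y x"
  by (simp add: bdot_def mult.commute)

lemma zariski_closure_nonzero: "y \<in> zariski_closure S \<Longrightarrow> y i \<noteq> 0"
  by (simp add: zariski_closure_def)

lemma zariski_closure_hyperplane:
  assumes "\<And>s. s \<in> S \<Longrightarrow> bdot a (s i) = 0" and "y \<in> zariski_closure S"
  shows "bdot a (y i) = 0"
proof -
  have "multihom_poly (\<lambda>i'. if i' = i then 1 else 0) (\<lambda>y. \<Sum>k\<in>UNIV. a $ k * y i $ k)"
    by (rule multihom_poly_linear_form)
  then show ?thesis
    using assms unfolding zariski_closure_def bdot_def by blast
qed

lemma zariski_closure_linear_image:
  fixes f :: "'m::finite \<Rightarrow> complex^'n::finite \<Rightarrow> complex^'k::finite"
  assumes f: "\<And>i. Vector_Spaces.linear (*s) (*s) (f i)"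
    and y: "y \<in> zariski_closure S" and nonzero: "\<And>i. f i (y i) \<noteq> 0"
  shows "(\<lambda>i. f i (y i)) \<in> zariski_closure ((\<lambda>s i. f i (s i)) ` S)"
proof -
  have "p (\<lambda>i. f i (y i)) = 0"
    if p: "multihom_poly d p" and vanish: "\<forall>z \<in> (\<lambda>s i. f i (s i)) ` S. p z = 0" for d p
  proof -
    have "multihom_poly d (\<lambda>y. p (\<lambda>i. f i (y i)))"
      using p f by (rule multihom_poly_compose_linear)
    with vanish y show ?thesis
      unfolding zariski_closure_def by blast
  qed
  with nonzero show ?thesis
    unfolding zariski_closure_def by blast
qed

lemma zariski_closure_linear_iso_image:
  fixes \<psi> :: "'m::finite \<Rightarrow> complex^'n::finite \<Rightarrow> complex^'k::finite"
  assumes lin: "\<And>i. Vector_Spaces.linear (*s) (*s) (\<psi> i)"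
    and bij: "\<And>i. bij_betw (\<psi> i) {x. bdot (a i) x = 0} UNIV"
    and S: "\<And>s i. s \<in> S \<Longrightarrow> bdot (a i) (s i) = 0"
  shows "(\<lambda>y i. \<psi> i (y i)) ` zariski_closure S = zariski_closure ((\<lambda>y i. \<psi> i (y i)) ` S)"
proof
  define \<sigma> where "\<sigma> i = inv_into {x. bdot (a i) x = 0} (\<psi> i)" for i
  have inj: "inj_on (\<psi> i) {x. bdot (a i) x = 0}" and surj: "\<psi> i ` {x. bdot (a i) x = 0} = UNIV" for i
    using bij[of i] by (auto simp: bij_betw_def)
  have lin_\<sigma>: "Vector_Spaces.linear (*s) (*s) (\<sigma> i)" for i
    unfolding \<sigma>_def using subspace_hyperplane lin bij by (rule linear_inv_into_subspace)
  have \<psi>_\<sigma>: "\<psi> i (\<sigma> i z) = z" for i z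
    unfolding \<sigma>_def using surj by (simp add: f_inv_into_f)
  have \<sigma>_\<psi>: "\<sigma> i (\<psi> i x) = x" if "x \<in> {x. bdot (a i) x = 0}" for i x
    unfolding \<sigma>_def using inj that by simp
  have \<psi>_eq_0: "\<psi> i x = 0 \<longleftrightarrow> x = 0" if "x \<in> {x. bdot (a i) x = 0}" for i x
    using vec.linear_inj_on_iff_eq_0[OF lin subspace_hyperplane] inj that
    by (metis vec.linear_0[OF lin])
  show "(\<lambda>y i. \<psi> i (y i)) ` zariski_closure S \<subseteq> zariski_closure ((\<lambda>y i. \<psi> i (y i)) ` S)"
  proof clarify
    fix y assume y: "y \<in> zariski_closure S"
    have "bdot (a i) (y i) = 0" for i
      using zariski_closure_hyperplane[of S "a i" i] S y by blast
    then have "\<psi> i (y i) \<noteq> 0" for i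
      using zariski_closure_nonzero[OF y] \<psi>_eq_0 by blast
    then show "(\<lambda>i. \<psi> i (y i)) \<in> zariski_closure ((\<lambda>y i. \<psi> i (y i)) ` S)"
      by (rule zariski_closure_linear_image[OF lin y])
  qed
  show "zariski_closure ((\<lambda>y i. \<psi> i (y i)) ` S) \<subseteq> (\<lambda>y i. \<psi> i (y i)) ` zariski_closure S"
  proof
    fix z assume z: "z \<in> zariski_closure ((\<lambda>y i. \<psi> i (y i)) ` S)"
    have "\<sigma> i (z i) \<noteq> 0" for i
      using zariski_closure_nonzero[OF z, of i] \<psi>_\<sigma>[of i "z i"] vec.linear_0[OF lin] by metis
    then have "(\<lambda>i. \<sigma> i (z i)) \<in> zariski_closure ((\<lambda>w i. \<sigma> i (w i)) ` (\<lambda>y i. \<psi> i (y i)) ` S)"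
      by (rule zariski_closure_linear_image[OF lin_\<sigma> z])
    also have "(\<lambda>w i. \<sigma> i (w i)) ` (\<lambda>y i. \<psi> i (y i)) ` S = S"
      using \<sigma>_\<psi> S by (force simp: image_image)
    finally show "z \<in> (\<lambda>y i. \<psi> i (y i)) ` zariski_closure S"
      by (rule image_eqI[rotated]) (simp add: \<psi>_\<sigma>)
  qed
qed

lemma proj_tuple_eq_reflect_linear:
  assumes lin: "\<And>i. Vector_Spaces.linear (*s) (*s) (\<psi> i)"
    and inj: "\<And>i. inj_on (\<psi> i) (V i)" and V: "\<And>i. vec.subspace (V i)"
    and y: "\<And>i. y i \<in> V i" and y': "\<And>i. y' i \<in> V i"
    and eq: "proj_tuple_eq (\<lambda>i. \<psi> i (y i)) (\<lambda>i. \<psi> i (y' i))"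
  shows "proj_tuple_eq y y'"
  unfolding proj_tuple_eq_def
proof
  fix i
  obtain c where "c \<noteq> 0" and c: "\<psi> i (y' i) = \<psi> i (c *s y i)"
    using eq vec.linear_scale[OF lin] unfolding proj_tuple_eq_def by metis
  moreover have "c *s y i \<in> V i"
    using V y by (rule vec.subspace_scale)
  ultimately show "\<exists>c. c \<noteq> 0 \<and> y' i = c *s y i"
    using inj_onD[OF inj c y'] by blast
qed

lemma zariski_closure_proj_tuple_eq_reflect:
  fixes \<psi> :: "'m::finite \<Rightarrow> complex^'n::finite \<Rightarrow> complex^'k::finite"
  assumes lin: "\<And>i. Vector_Spaces.linear (*s) (*s) (\<psi> i)"
    and inj: "\<And>i. inj_on (\<psi> i) {x. bdot (a i) x = 0}"
    and S: "\<And>s i. s \<in> S \<Longrightarrow> bdot (a i) (s i) = 0"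
    and y: "y \<in> zariski_closure S" and y': "y' \<in> zariski_closure S"
    and eq: "proj_tuple_eq (\<lambda>i. \<psi> i (y i)) (\<lambda>i. \<psi> i (y' i))"
  shows "proj_tuple_eq y y'"
proof (rule proj_tuple_eq_reflect_linear[OF lin inj subspace_hyperplane _ _ eq])
  show "y i \<in> {x. bdot (a i) x = 0}" "y' i \<in> {x. bdot (a i) x = 0}" for i
    using zariski_closure_hyperplane[of S "a i" i] S y y' by auto
qed

text \<open>The maps \<open>h i\<close> need only be linear on \<open>W\<close>: this is all that holds for
  \<^const>\<open>cam_on_Lambda\<close>, which is defined by a choice outside \<open>Lambda_pt X\<close>.\<close>

lemma linear_reparametrization:
  fixes \<phi> :: "'a::field^'n \<Rightarrow> 'a^'k" and h :: "'m \<Rightarrow> 'a^'n \<Rightarrow> 'a^'l"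
    and \<psi> :: "'m \<Rightarrow> 'a^'l \<Rightarrow> 'a^'p"
  assumes W: "vec.subspace W" and lin_\<phi>: "Vector_Spaces.linear (*s) (*s) \<phi>"
    and bij_\<phi>: "bij_betw \<phi> W UNIV"
    and h_add: "\<And>i x y. x \<in> W \<Longrightarrow> y \<in> W \<Longrightarrow> h i (x + y) = h i x + h i y"
    and h_scale: "\<And>i c x. x \<in> W \<Longrightarrow> h i (c *s x) = c *s h i x"
    and lin_\<psi>: "\<And>i. Vector_Spaces.linear (*s) (*s) (\<psi> i)"
    and inj_\<psi>: "\<And>i. inj_on (\<psi> i) (V i)" and h_V: "\<And>i x. x \<in> W \<Longrightarrow> h i x \<in> V i"
  shows "{(\<lambda>i. matrix (\<lambda>w. \<psi> i (h i (inv_into W \<phi> w))) *v Y) | Y. Y \<noteq> 0 \<and>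
            (\<forall>i. matrix (\<lambda>w. \<psi> i (h i (inv_into W \<phi> w))) *v Y \<noteq> 0)}
       = (\<lambda>y i. \<psi> i (y i)) ` {(\<lambda>i. h i x) | x. x \<in> W \<and> x \<noteq> 0 \<and> (\<forall>i. h i x \<noteq> 0)}"
proof -
  define \<phi>' where "\<phi>' = inv_into W \<phi>"
  have lin_\<phi>': "Vector_Spaces.linear (*s) (*s) \<phi>'"
    unfolding \<phi>'_def using W lin_\<phi> bij_\<phi> by (rule linear_inv_into_subspace)
  have \<phi>'_W: "\<phi>' w \<in> W" and \<phi>_\<phi>': "\<phi> (\<phi>' w) = w" for w
    using bij_\<phi> unfolding \<phi>'_def bij_betw_def by (auto intro: inv_into_into f_inv_into_f)
  have \<phi>'_\<phi>: "x \<in> W \<Longrightarrow> \<phi>' (\<phi> x) = x" for x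
    using bij_\<phi> unfolding \<phi>'_def bij_betw_def by simp
  have \<phi>'_eq_0: "\<phi>' w = 0 \<longleftrightarrow> w = 0" for w
    using \<phi>_\<phi>'[of w] vec.linear_0[OF lin_\<phi>] vec.linear_0[OF lin_\<phi>'] by metis
  have h_0: "h i 0 = 0" for i
    using h_scale[of 0 i 0] vec.subspace_0[OF W] by simp
  have \<psi>_h_eq_0: "\<psi> i (h i x) = 0 \<longleftrightarrow> h i x = 0" if "x \<in> W" for i x
    using inj_onD[OF inj_\<psi> _ h_V[OF that] h_V[OF vec.subspace_0[OF W]]] h_0 vec.linear_0[OF lin_\<psi>]
    by metis
  have "Vector_Spaces.linear (*s) (*s) (\<lambda>w. \<psi> i (h i (\<phi>' w)))" for i
    by (rule linear_vecI) (simp_all add: \<phi>'_W h_add h_scale vec.linear_add[OF lin_\<phi>']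
        vec.linear_scale[OF lin_\<phi>'] vec.linear_add[OF lin_\<psi>] vec.linear_scale[OF lin_\<psi>])
  then have matrix_eq: "matrix (\<lambda>w. \<psi> i (h i (\<phi>' w))) *v Y = \<psi> i (h i (\<phi>' Y))" for i Y
    by (rule matrix_works)
  show ?thesis
    unfolding \<phi>'_def[symmetric] matrix_eq
  proof (intro equalityI subsetI)
    fix z assume "z \<in> {(\<lambda>i. \<psi> i (h i (\<phi>' Y))) | Y. Y \<noteq> 0 \<and> (\<forall>i. \<psi> i (h i (\<phi>' Y)) \<noteq> 0)}"
    then obtain Y where Y: "Y \<noteq> 0" "\<And>i. \<psi> i (h i (\<phi>' Y)) \<noteq> 0"
      and z: "z = (\<lambda>i. \<psi> i (h i (\<phi>' Y)))"
      by blast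
    have "\<phi>' Y \<noteq> 0" and "h i (\<phi>' Y) \<noteq> 0" for i
      using Y \<phi>'_eq_0 \<psi>_h_eq_0[OF \<phi>'_W] by auto
    with \<phi>'_W have "(\<lambda>i. h i (\<phi>' Y)) \<in> {(\<lambda>i. h i x) | x. x \<in> W \<and> x \<noteq> 0 \<and> (\<forall>i. h i x \<noteq> 0)}"
      by blast
    then show "z \<in> (\<lambda>y i. \<psi> i (y i)) ` {(\<lambda>i. h i x) | x. x \<in> W \<and> x \<noteq> 0 \<and> (\<forall>i. h i x \<noteq> 0)}"
      by (rule rev_image_eqI) (simp add: z)
  next
    fix z assume "z \<in> (\<lambda>y i. \<psi> i (y i)) ` {(\<lambda>i. h i x) | x. x \<in> W \<and> x \<noteq> 0 \<and> (\<forall>i. h i x \<noteq> 0)}"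
    then obtain x where x: "x \<in> W" "x \<noteq> 0" "\<And>i. h i x \<noteq> 0" and z: "z = (\<lambda>i. \<psi> i (h i x))"
      by blast
    have "\<phi> x \<noteq> 0" and "\<psi> i (h i (\<phi>' (\<phi> x))) \<noteq> 0" for i
      using x \<phi>'_\<phi>[OF x(1)] \<phi>'_eq_0[of "\<phi> x"] \<psi>_h_eq_0 by auto
    then show "z \<in> {(\<lambda>i. \<psi> i (h i (\<phi>' Y))) | Y. Y \<noteq> 0 \<and> (\<forall>i. \<psi> i (h i (\<phi>' Y)) \<noteq> 0)}"
      by (intro CollectI exI[of _ "\<phi> x"]) (simp add: z \<phi>'_\<phi>[OF x(1)])
  qed
qed

section \<open>Image lines, pencils and Pluecker coordinates\<close>

lemma linear_ccross: "Vector_Spaces.linear (*s) (*s) (ccross p)"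
  by (rule linear_vecI; unfold vec_eq_iff forall_3; simp add: ccross_def algebra_simps)

lemma bdot_ccross_left: "bdot (ccross p q) p = 0"
  and bdot_ccross_right: "bdot (ccross p q) q = 0"
  by (simp_all add: bdot_def sum_3 ccross_def algebra_simps)

lemma linear_cam_line: "Vector_Spaces.linear (*s) (*s) (cam_line C X)"
proof -
  have "cam_line C X = ccross (C *v X) \<circ> (\<lambda>Z. C *v Z)"
    by (simp add: fun_eq_iff cam_line_def)
  then show ?thesis
    using Vector_Spaces.linear_compose[OF matrix_vector_mul_linear_gen linear_ccross] by simp
qed

lemma span_image_in_image_line:
  assumes "Y \<in> vec.span {u, v}"
  shows "C *v Y \<in> image_line (cam_line C u v)"
proof -
  have "vec.subspace ((\<lambda>Y. C *v Y) -` {x. bdot (cam_line C u v) x = 0})"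
    using matrix_vector_mul_linear_gen subspace_hyperplane by (rule vec.linear_subspace_vimage)
  moreover have "{u, v} \<subseteq> (\<lambda>Y. C *v Y) -` {x. bdot (cam_line C u v) x = 0}"
    by (simp add: cam_line_def bdot_ccross_left bdot_ccross_right)
  ultimately show ?thesis
    using vec.span_minimal assms unfolding image_line_def by blast
qed

lemma exhaust_6:
  fixes x :: 6
  shows "x = 1 \<or> x = 2 \<or> x = 3 \<or> x = 4 \<or> x = 5 \<or> x = 6"
proof (induct x)
  case (of_int z)
  then have "z = 0 \<or> z = 1 \<or> z = 2 \<or> z = 3 \<or> z = 4 \<or> z = 5" by fastforce
  then show ?case by auto
qed

lemma forall_6: "(\<forall>i::6. P i) \<longleftrightarrow> P 1 \<and> P 2 \<and> P 3 \<and> P 4 \<and> P 5 \<and> P 6"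
  by (metis exhaust_6)

lemma vector_6:
  "(vector [a, b, c, d, e, f] :: 'a::zero^6) $ 1 = a"
  "(vector [a, b, c, d, e, f] :: 'a::zero^6) $ 2 = b"
  "(vector [a, b, c, d, e, f] :: 'a::zero^6) $ 3 = c"
  "(vector [a, b, c, d, e, f] :: 'a::zero^6) $ 4 = d"
  "(vector [a, b, c, d, e, f] :: 'a::zero^6) $ 5 = e"
  "(vector [a, b, c, d, e, f] :: 'a::zero^6) $ 6 = f"
  unfolding vector_def by simp_all

lemma linear_pluecker: "Vector_Spaces.linear (*s) (*s) (pluecker X)"
  by (rule linear_vecI; unfold vec_eq_iff forall_6; simp add: pluecker_def vector_6 algebra_simps)

lemma pluecker_eq_0_iff:
  assumes "X \<noteq> 0"
  shows "pluecker X Z = 0 \<longleftrightarrow> Z \<in> vec.span {X}"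
proof
  assume "pluecker X Z = 0"
  then have eqs: "X$1 * Z$2 = X$2 * Z$1" "X$1 * Z$3 = X$3 * Z$1" "X$1 * Z$4 = X$4 * Z$1"
    "X$2 * Z$3 = X$3 * Z$2" "X$2 * Z$4 = X$4 * Z$2" "X$3 * Z$4 = X$4 * Z$3"
    unfolding vec_eq_iff forall_6 by (simp_all add: pluecker_def vector_6)
  obtain k where k: "X$k \<noteq> 0"
    using assms by (auto simp: vec_eq_iff)
  have "Z = (Z$k / X$k) *s X"
    unfolding vec_eq_iff forall_4 using exhaust_4[of k] k eqs by (auto simp: field_simps)
  then show "Z \<in> vec.span {X}"
    by (metis vec.span_base vec.span_scale singletonI)
next
  assume "Z \<in> vec.span {X}"
  then obtain t where "Z = t *s X"
    by (auto simp: vec.span_singleton)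
  then show "pluecker X Z = 0"
    unfolding vec_eq_iff forall_6 by (simp add: pluecker_def vector_6)
qed

lemma independent_pair_iff:
  fixes X Z :: "'a::field^'n"
  assumes "X \<noteq> 0"
  shows "vec.independent {X, Z} \<and> X \<noteq> Z \<longleftrightarrow> Z \<notin> vec.span {X}"
  using assms vec.span_base[of X "{X}"]
  by (auto simp: insert_commute[of X Z] vec.independent_insert)

lemma subspace_Lambda_pt: "vec.subspace (Lambda_pt X)"
  unfolding Lambda_pt_def using linear_pluecker vec.subspace_UNIV
  by (rule vec.linear_subspace_image)

text \<open>The chosen \<open>Z\<close> with \<open>pluecker X Z = p\<close> is only determined up to adding a
  multiple of \<open>X\<close>, which \<^const>\<open>cam_line\<close> ignores.\<close>

lemma cam_on_Lambda_pluecker: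
  assumes "X \<noteq> 0"
  shows "cam_on_Lambda C X (pluecker X Z) = cam_line C X Z"
proof -
  define Z' where "Z' = (SOME Z'. pluecker X Z' = pluecker X Z)"
  have "pluecker X Z' = pluecker X Z"
    unfolding Z'_def by (rule someI) (rule refl)
  then have "pluecker X (Z' - Z) = 0"
    by (simp add: vec.linear_diff[OF linear_pluecker])
  then have "Z' - Z \<in> vec.span {X}"
    using pluecker_eq_0_iff[OF assms] by simp
  then obtain t where "Z' - Z = t *s X"
    by (auto simp: vec.span_singleton)
  then have "Z' = Z + t *s X"
    by (simp add: algebra_simps)
  moreover have "cam_line C X X = 0"
    unfolding cam_line_def vec_eq_iff forall_3 by (simp add: ccross_def)
  ultimately show ?thesis
    by (simp add: cam_on_Lambda_def Z'_def[symmetric] vec.linear_add[OF linear_cam_line]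
        vec.linear_scale[OF linear_cam_line])
qed

lemma dual_pencil_eq_hyperplane: "dual_pencil y = {l. bdot y l = 0}"
  by (simp add: dual_pencil_def bdot_commute)

lemma cam_on_Lambda_add:
  assumes "X \<noteq> 0" and "p \<in> Lambda_pt X" and "q \<in> Lambda_pt X"
  shows "cam_on_Lambda C X (p + q) = cam_on_Lambda C X p + cam_on_Lambda C X q"
  using assms
  by (auto simp: Lambda_pt_def cam_on_Lambda_pluecker vec.linear_add[OF linear_cam_line]
      vec.linear_add[OF linear_pluecker, symmetric])

lemma cam_on_Lambda_scale:
  assumes "X \<noteq> 0" and "p \<in> Lambda_pt X"
  shows "cam_on_Lambda C X (c *s p) = c *s cam_on_Lambda C X p"
  using assms
  by (auto simp: Lambda_pt_def cam_on_Lambda_pluecker vec.linear_scale[OF linear_cam_line]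
      vec.linear_scale[OF linear_pluecker, symmetric])

lemma lines_through_point_pluecker:
  assumes X: "X \<noteq> 0"
  shows "{(\<lambda>i. cam_line (C i) X Z) | Z.
            vec.independent {X, Z} \<and> X \<noteq> Z \<and> (\<forall>i. cam_line (C i) X Z \<noteq> 0)}
       = {(\<lambda>i. cam_on_Lambda (C i) X p) | p.
            p \<in> Lambda_pt X \<and> p \<noteq> 0 \<and> (\<forall>i. cam_on_Lambda (C i) X p \<noteq> 0)}"
proof -
  have independent: "pluecker X Z \<noteq> 0 \<longleftrightarrow> vec.independent {X, Z} \<and> X \<noteq> Z" for Z
    using independent_pair_iff[OF X] pluecker_eq_0_iff[OF X] by blast
  have "{(\<lambda>i. cam_on_Lambda (C i) X p) | p.
          p \<in> Lambda_pt X \<and> p \<noteq> 0 \<and> (\<forall>i. cam_on_Lambda (C i) X p \<noteq> 0)}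
      = {(\<lambda>i. cam_on_Lambda (C i) X (pluecker X Z)) | Z.
          pluecker X Z \<noteq> 0 \<and> (\<forall>i. cam_on_Lambda (C i) X (pluecker X Z) \<noteq> 0)}"
    unfolding Lambda_pt_def by blast
  then show ?thesis
    by (simp add: cam_on_Lambda_pluecker[OF X] independent)
qed

section \<open>The reduced arrangements\<close>

lemma M_line_linear_iso:
  fixes C :: "'m::finite \<Rightarrow> complex^4^3" and \<phi> :: "complex^4 \<Rightarrow> complex^2"
    and \<psi> :: "'m \<Rightarrow> complex^3 \<Rightarrow> complex^2"
  assumes lin_\<phi>: "Vector_Spaces.linear (*s) (*s) \<phi>" and bij_\<phi>: "bij_betw \<phi> (vec.span {u, v}) UNIV"
    and lin_\<psi>: "\<And>i. Vector_Spaces.linear (*s) (*s) (\<psi> i)"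
    and bij_\<psi>: "\<And>i. bij_betw (\<psi> i) (image_line (cam_line (C i) u v)) UNIV"
  shows "(\<lambda>y i. \<psi> i (y i)) ` M_line C u v
           = M11 (\<lambda>i. matrix (\<lambda>w. \<psi> i (C i *v inv_into (vec.span {u, v}) \<phi> w)))"
    and "y \<in> M_line C u v \<Longrightarrow> y' \<in> M_line C u v \<Longrightarrow>
           proj_tuple_eq (\<lambda>i. \<psi> i (y i)) (\<lambda>i. \<psi> i (y' i)) \<Longrightarrow> proj_tuple_eq y y'"
proof -
  let ?S = "{(\<lambda>i. C i *v Y) | Y. Y \<in> vec.span {u, v} \<and> Y \<noteq> 0 \<and> (\<forall>i. C i *v Y \<noteq> 0)}"
  let ?V = "\<lambda>i. {x. bdot (cam_line (C i) u v) x = 0}"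
  have bij: "bij_betw (\<psi> i) (?V i) UNIV" for i
    using bij_\<psi>[of i] by (simp add: image_line_def)
  then have inj: "inj_on (\<psi> i) (?V i)" for i
    by (simp add: bij_betw_def)
  have S: "bdot (cam_line (C i) u v) (s i) = 0" if "s \<in> ?S" for s i
    using that span_image_in_image_line by (auto simp: image_line_def)
  have "{(\<lambda>i. matrix (\<lambda>w. \<psi> i (C i *v inv_into (vec.span {u, v}) \<phi> w)) *v Y) | Y. Y \<noteq> 0 \<and>
          (\<forall>i. matrix (\<lambda>w. \<psi> i (C i *v inv_into (vec.span {u, v}) \<phi> w)) *v Y \<noteq> 0)}
      = (\<lambda>y i. \<psi> i (y i)) ` ?S"
    by (rule linear_reparametrization[OF vec.subspace_span lin_\<phi> bij_\<phi> _ _ lin_\<psi> inj])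
      (simp_all add: matrix_vector_right_distrib vec.linear_scale[OF matrix_vector_mul_linear_gen]
        span_image_in_image_line[unfolded image_line_def mem_Collect_eq])
  then show "(\<lambda>y i. \<psi> i (y i)) ` M_line C u v
      = M11 (\<lambda>i. matrix (\<lambda>w. \<psi> i (C i *v inv_into (vec.span {u, v}) \<phi> w)))"
    using zariski_closure_linear_iso_image[of \<psi> "\<lambda>i. cam_line (C i) u v" ?S] lin_\<psi> bij S
    unfolding M_line_def M11_def by simp
  show "proj_tuple_eq y y'"
    if "y \<in> M_line C u v" and "y' \<in> M_line C u v"
      and "proj_tuple_eq (\<lambda>i. \<psi> i (y i)) (\<lambda>i. \<psi> i (y' i))"
    using zariski_closure_proj_tuple_eq_reflect[of \<psi> "\<lambda>i. cam_line (C i) u v" ?S] lin_\<psi> inj S that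
    unfolding M_line_def by blast
qed

lemma L_point_linear_iso:
  fixes C :: "'m::finite \<Rightarrow> complex^4^3" and \<phi> :: "complex^6 \<Rightarrow> complex^3"
    and \<psi> :: "'m \<Rightarrow> complex^3 \<Rightarrow> complex^2"
  assumes X: "X \<noteq> 0"
    and lin_\<phi>: "Vector_Spaces.linear (*s) (*s) \<phi>" and bij_\<phi>: "bij_betw \<phi> (Lambda_pt X) UNIV"
    and lin_\<psi>: "\<And>i. Vector_Spaces.linear (*s) (*s) (\<psi> i)"
    and bij_\<psi>: "\<And>i. bij_betw (\<psi> i) (dual_pencil (C i *v X)) UNIV"
  shows "(\<lambda>y i. \<psi> i (y i)) ` L_point C X
           = M21 (\<lambda>i. matrix (\<lambda>w. \<psi> i (cam_on_Lambda (C i) X (inv_into (Lambda_pt X) \<phi> w))))"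
    and "y \<in> L_point C X \<Longrightarrow> y' \<in> L_point C X \<Longrightarrow>
           proj_tuple_eq (\<lambda>i. \<psi> i (y i)) (\<lambda>i. \<psi> i (y' i)) \<Longrightarrow> proj_tuple_eq y y'"
proof -
  let ?S = "{(\<lambda>i. cam_on_Lambda (C i) X p) | p.
    p \<in> Lambda_pt X \<and> p \<noteq> 0 \<and> (\<forall>i. cam_on_Lambda (C i) X p \<noteq> 0)}"
  let ?V = "\<lambda>i. {x. bdot (C i *v X) x = 0}"
  have L_point_eq: "L_point C X = zariski_closure ?S"
    by (simp add: L_point_def lines_through_point_pluecker[OF X])
  have bij: "bij_betw (\<psi> i) (?V i) UNIV" for i
    using bij_\<psi>[of i] by (simp add: dual_pencil_eq_hyperplane)
  then have inj: "inj_on (\<psi> i) (?V i)" for i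
    by (simp add: bij_betw_def)
  have in_V: "bdot (C i *v X) (cam_on_Lambda (C i) X p) = 0" if "p \<in> Lambda_pt X" for p i
    using that bdot_ccross_left[of "C i *v X"]
    by (auto simp: Lambda_pt_def cam_on_Lambda_pluecker[OF X] cam_line_def bdot_commute[of "C i *v X"])
  then have S: "bdot (C i *v X) (s i) = 0" if "s \<in> ?S" for s i
    using that by auto
  have "{(\<lambda>i. matrix (\<lambda>w. \<psi> i (cam_on_Lambda (C i) X (inv_into (Lambda_pt X) \<phi> w))) *v Y) | Y. Y \<noteq> 0 \<and>
          (\<forall>i. matrix (\<lambda>w. \<psi> i (cam_on_Lambda (C i) X (inv_into (Lambda_pt X) \<phi> w))) *v Y \<noteq> 0)}
      = (\<lambda>y i. \<psi> i (y i)) ` ?S"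
    by (rule linear_reparametrization[OF subspace_Lambda_pt lin_\<phi> bij_\<phi> _ _ lin_\<psi> inj])
      (simp_all add: cam_on_Lambda_add[OF X] cam_on_Lambda_scale[OF X] in_V)
  then show "(\<lambda>y i. \<psi> i (y i)) ` L_point C X
      = M21 (\<lambda>i. matrix (\<lambda>w. \<psi> i (cam_on_Lambda (C i) X (inv_into (Lambda_pt X) \<phi> w))))"
    using zariski_closure_linear_iso_image[of \<psi> "\<lambda>i. C i *v X" ?S] lin_\<psi> bij S
    unfolding L_point_eq M21_def by simp
  show "proj_tuple_eq y y'"
    if "y \<in> L_point C X" and "y' \<in> L_point C X"
      and "proj_tuple_eq (\<lambda>i. \<psi> i (y i)) (\<lambda>i. \<psi> i (y' i))"
    using zariski_closure_proj_tuple_eq_reflect[of \<psi> "\<lambda>i. C i *v X" ?S] lin_\<psi> inj S that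
    unfolding L_point_eq by blast
qed

theorem theorem1p3:
  fixes C :: "'m::finite \<Rightarrow> complex^4^3"
  assumes "camera_arrangement C"
  shows
  "(\<forall>(u::complex^4) v (\<phi>::complex^4 \<Rightarrow> complex^2) (\<psi>::'m \<Rightarrow> complex^3 \<Rightarrow> complex^2).
      vec.independent {u, v} \<and> u \<noteq> v \<and>
      (\<forall>i. \<not> (\<exists>c \<in> vec.span {u, v}. is_center (C i) c)) \<and>
      Vector_Spaces.linear (*s) (*s) \<phi> \<and> bij_betw \<phi> (vec.span {u, v}) UNIV \<and>
      (\<forall>i. Vector_Spaces.linear (*s) (*s) (\<psi> i) \<and>
           bij_betw (\<psi> i) (image_line (cam_line (C i) u v)) UNIV)
    \<longrightarrow> (let Ct = (\<lambda>i. matrix (\<lambda>w. \<psi> i (C i *v inv_into (vec.span {u, v}) \<phi> w)))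
         in (\<lambda>y i. \<psi> i (y i)) ` M_line C u v = M11 Ct \<and>
            (\<forall>y\<in>M_line C u v. \<forall>y'\<in>M_line C u v.
               proj_tuple_eq (\<lambda>i. \<psi> i (y i)) (\<lambda>i. \<psi> i (y' i)) \<longrightarrow> proj_tuple_eq y y')))
   \<and>
   (\<forall>(X::complex^4) (\<phi>::complex^6 \<Rightarrow> complex^3) (\<psi>::'m \<Rightarrow> complex^3 \<Rightarrow> complex^2).
      X \<noteq> 0 \<and> (\<forall>i. \<not> is_center (C i) X) \<and>
      Vector_Spaces.linear (*s) (*s) \<phi> \<and> bij_betw \<phi> (Lambda_pt X) UNIV \<and>
      (\<forall>i. Vector_Spaces.linear (*s) (*s) (\<psi> i) \<and>
           bij_betw (\<psi> i) (dual_pencil (C i *v X)) UNIV)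
    \<longrightarrow> (let Ch = (\<lambda>i. matrix (\<lambda>w. \<psi> i (cam_on_Lambda (C i) X (inv_into (Lambda_pt X) \<phi> w))))
         in (\<lambda>y i. \<psi> i (y i)) ` L_point C X = M21 Ch \<and>
            (\<forall>y\<in>L_point C X. \<forall>y'\<in>L_point C X.
               proj_tuple_eq (\<lambda>i. \<psi> i (y i)) (\<lambda>i. \<psi> i (y' i)) \<longrightarrow> proj_tuple_eq y y')))"
proof (intro conjI allI impI, goal_cases)
  case (1 u v \<phi> \<psi>)
  then show ?case
    using M_line_linear_iso[where C = C and \<phi> = \<phi> and \<psi> = \<psi>] by (auto simp: Let_def)
next
  case (2 X \<phi> \<psi>)
  then show ?case
    using L_point_linear_iso[where C = C and \<phi> = \<phi> and \<psi> = \<psi>] by (auto simp: Let_def)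
qed

end
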